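(* Let $(\mathfrak A,\mathfrak B)$ be an access structure on $[\mathsf n]$ and let $\mathcal P=(\mathsf G,\tau)$ be an $(\mathfrak A,\mathfrak B,\mathsf n)$-MMSP with matrix $\mathsf G=(\mathsf G',\mathsf G'')\in\mathbb F_q^{\mathsf z\times\mathsf x}\times\mathbb F_q^{\mathsf z\times\mathsf y}$, position map $\tau:[\mathsf z]\to[\mathsf n]$ and rate $\mathsf x/\mathsf z$. Then for any $\mathsf f\ge2$, the projected linear SPIR protocol with $\mathsf f$ files described by the triplet $(\mathsf G'',\mathsf G',\tau)$ of randomness encoder $\mathsf G''$, user's query encoder $\mathsf G'$ and position map $\tau$ is an $(\mathfrak A,\mathfrak B,\mathsf n,\mathsf f)$-CSSPIR protocol with PIR rate $\mathsf x/\mathsf z$ and shared randomness rate $\mathsf y/\mathsf x$.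
   Context: Notation: $[n]=\{1,\dots,n\}$. For a tuple $A=(A_1,\dots,A_n)$ and $\mathcal X\subset[n]$, $A_{\mathcal X}=(A_i)_{i\in\mathcal X}$; for a matrix $\mathsf A$ with rows indexed by $[n]$, $\mathsf A_{\mathcal X}$ is the submatrix of rows indexed by $\mathcal X$. $I(\cdot;\cdot)$ is mutual information. $\mathsf n,\mathsf x,\mathsf y,\mathsf z$ are positive integers and $\mathbb F_q$ is a finite field. Access structure on $[\mathsf n]$: a pair $(\mathfrak A,\mathfrak B)$ of subsets of $2^{[\mathsf n]}$ with $\mathfrak A$ closed under supersets, $\mathfrak B$ closed under subsets, and $\mathfrak A\cap\mathfrak B=\emptyset$. MMSP (multi-target monotone span program): a pair $(\mathsf G,\tau)$ with $\mathsf G\in\mathbb F_q^{\mathsf z\times(\mathsf x+\mathsf y)}$ and $\tau:[\mathsf z]\to[\mathsf n]$. Let $\mathcal E=\{\mathbf e_1,\dots,\mathbf e_{\mathsf x}\}$ be the first $\mathsf x$ standard basis row vectors of $\mathbb F_q^{\mathsf x+\mathsf y}$. It is an $(\mathfrak A,\mathfrak B,\mathsf n)$-MMSP if $\mathcal E\subset\operatorname{rowspan}\mathsf G_{\tau^{-1}(\mathcal A)}$ for all $\mathcal A\in\mathfrak A$ (it accepts $\mathfrak A$), and $\operatorname{span}\mathcal E\cap\operatorname{rowspan}\mathsf G_{\tau^{-1}(\mathcal B)}=\{0\}$ for all $\mathcal B\in\mathfrak B$ (it rejects $\mathfrak B$). The MMSP rate is $\mathsf x/\mathsf z$. Projected linear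 SPIR protocol with $\mathsf f$ files described by $(\mathsf H,\mathsf J,\tau)$, where $\mathsf H\in\mathbb F_q^{\mathsf z\times\mathsf y}$, $\mathsf J\in\mathbb F_q^{\mathsf z\times\mathsf x}$, $\tau:[\mathsf z]\to[\mathsf n]$: the files $M_1,\dots,M_{\mathsf f}\in\mathbb F_q^{\mathsf x}$ (concatenated as $M\in\mathbb F_q^{\mathsf f\mathsf x}$), the random seed $U\in\mathbb F_q^{\mathsf y}$, the index $K\in[\mathsf f]$ and the user's randomness $R\in\mathbb F_q^{\mathsf y\times\mathsf f\mathsf x}$ are uniform and mutually independent. For $K=k$ the query matrix is $Q=\mathsf J\mathsf E_k+\mathsf HR\in\mathbb F_q^{\mathsf z\times\mathsf f\mathsf x}$, where $\mathsf E_k\in\mathbb F_q^{\mathsf x\times\mathsf f\mathsf x}$ has $k$-th $\mathsf x\times\mathsf x$ block equal to the identity and all other blocks zero; server $j$ receives the rows $Q_{\tau^{-1}(j)}$ and answers $D_j=Q_{\tau^{-1}(j)}M+\mathsf H_{\tau^{-1}(j)}U\in\mathbb F_q^{|\tau^{-1}(j)|}$. Put $D=(D_1,\dots,D_{\mathsf n})$. It is an $(\mathfrak A,\mathfrak B,\mathsf n,\mathsf f)$-CSSPIR protocol (completely secure SPIR) if: - Correctness: for all values $r$ of $R$, all $k\in[\mathsf f]$ and $\mathcal A\in\mathfrak A$, given $K=k,R=r$ the maximum likelihood decoder of $M_k$ from $D_{\mathcal A}$ has error probability $0$ (i.e. $M_k$ is a function of $D_{\mathcal A}$). - Server secrecy: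 $I(D;M_{[\mathsf f]\setminus\{k\}}\mid R=r,K=k)=0$ for all $r,k$. - User secrecy: $I(K;Q_{\tau^{-1}(\mathcal B)})=0$ for all $\mathcal B\in\mathfrak B$ ($Q_{\tau^{-1}(\mathcal B)}$ being the queries received by the servers in $\mathcal B$). The PIR rate is $\log|\mathbb F_q^{\mathsf x}|/\sum_j\log|\mathbb F_q^{|\tau^{-1}(j)|}|$ and the shared randomness rate is $\log|\mathbb F_q^{\mathsf y}|/\log|\mathbb F_q^{\mathsf x}|$. *)

theory Defs
  imports "HOL-Probability.Information" "Jordan_Normal_Form.VS_Connect"
    "Jordan_Normal_Form.DL_Submatrix"
begin

text \<open>
  All index sets are zero-based: \<open>[n]\<close> is \<open>{..<n}\<close>. The finite field is a type of class
  \<open>{field, finite}\<close>; matrices and vectors are those with explicit natural-number dimensions.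
\<close>

definition access_structure :: "nat \<Rightarrow> nat set set \<Rightarrow> nat set set \<Rightarrow> bool" where
  "access_structure n \<AA> \<BB> \<longleftrightarrow>
     \<AA> \<subseteq> Pow {..<n} \<and> \<BB> \<subseteq> Pow {..<n} \<and>
     (\<forall>A\<in>\<AA>. \<forall>A'. A \<subseteq> A' \<and> A' \<subseteq> {..<n} \<longrightarrow> A' \<in> \<AA>) \<and>
     (\<forall>B\<in>\<BB>. \<forall>B'. B' \<subseteq> B \<longrightarrow> B' \<in> \<BB>) \<and>
     \<AA> \<inter> \<BB> = {}"

text \<open>\<open>rows_at \<tau> A X\<close> is the submatrix of the rows of \<open>A\<close> indexed by \<open>\<tau>\<^sup>-\<^sup>1(X)\<close>, in increasing
  order, where the domain of \<open>\<tau>\<close> is the row index set of \<open>A\<close>.\<close>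

definition rows_at :: "(nat \<Rightarrow> nat) \<Rightarrow> 'a mat \<Rightarrow> nat set \<Rightarrow> 'a mat" where
  "rows_at \<tau> A X = submatrix A {i. i < dim_row A \<and> \<tau> i \<in> X} UNIV"

definition hcat :: "'a :: zero mat \<Rightarrow> 'a mat \<Rightarrow> 'a mat" where
  "hcat A B = four_block_mat A B (0\<^sub>m 0 (dim_col A)) (0\<^sub>m 0 (dim_col B))"

definition target_vecs :: "nat \<Rightarrow> nat \<Rightarrow> 'a :: field vec set" where
  "target_vecs x y = {unit_vec (x + y) i | i. i < x}"

definition accepts :: "nat \<Rightarrow> nat \<Rightarrow> 'a :: field mat \<Rightarrow> (nat \<Rightarrow> nat) \<Rightarrow> nat set set \<Rightarrow> bool" where
  "accepts x y G \<tau> \<AA> \<longleftrightarrow>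
     (\<forall>A\<in>\<AA>. target_vecs x y \<subseteq> vec_space.row_space (x + y) (rows_at \<tau> G A))"

definition rejects :: "nat \<Rightarrow> nat \<Rightarrow> 'a :: field mat \<Rightarrow> (nat \<Rightarrow> nat) \<Rightarrow> nat set set \<Rightarrow> bool" where
  "rejects x y G \<tau> \<BB> \<longleftrightarrow>
     (\<forall>B\<in>\<BB>. LinearCombinations.module.span class_ring (module_vec TYPE('a) (x + y)) (target_vecs x y)
             \<inter> vec_space.row_space (x + y) (rows_at \<tau> G B) = {0\<^sub>v (x + y)})"

definition is_mmsp ::
  "nat set set \<Rightarrow> nat set set \<Rightarrow> nat \<Rightarrow> nat \<Rightarrow> nat \<Rightarrow> nat \<Rightarrow> 'a :: field mat \<Rightarrow> (nat \<Rightarrow> nat) \<Rightarrow> bool" where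
  "is_mmsp \<AA> \<BB> n x y z G \<tau> \<longleftrightarrow>
     G \<in> carrier_mat z (x + y) \<and> \<tau> \<in> {..<z} \<rightarrow> {..<n} \<and>
     accepts x y G \<tau> \<AA> \<and> rejects x y G \<tau> \<BB>"

text \<open>In a protocol description \<open>(H, J, \<tau>)\<close> the parameters are read off from the matrices:
  \<open>x = dim_col J\<close>, \<open>y = dim_col H\<close>, \<open>z = dim_row H = dim_row J\<close>.\<close>

definition spir_description :: "nat \<Rightarrow> 'a mat \<Rightarrow> 'a mat \<Rightarrow> (nat \<Rightarrow> nat) \<Rightarrow> bool" where
  "spir_description n H J \<tau> \<longleftrightarrow> dim_row H = dim_row J \<and> \<tau> \<in> {..<dim_row H} \<rightarrow> {..<n}"

record 'a outcome =
  Files :: "nat \<Rightarrow> 'a vec"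
  Seed :: "'a vec"
  Index :: nat
  UserRand :: "'a mat"

text \<open>The uniform distribution on the product of the ranges: this is the joint law for which the
  files, the seed, the index and the user's randomness are uniform and mutually independent.\<close>

definition spir_outcomes :: "nat \<Rightarrow> 'a mat \<Rightarrow> 'a mat \<Rightarrow> 'a outcome set" where
  "spir_outcomes f H J =
     {\<omega>. Files \<omega> \<in> ({..<f} \<rightarrow>\<^sub>E carrier_vec (dim_col J)) \<and> Seed \<omega> \<in> carrier_vec (dim_col H) \<and>
         Index \<omega> \<in> {..<f} \<and> UserRand \<omega> \<in> carrier_mat (dim_col H) (f * dim_col J)}"

definition spir_space :: "nat \<Rightarrow> 'a mat \<Rightarrow> 'a mat \<Rightarrow> 'a outcome measure" where
  "spir_space f H J = uniform_count_measure (spir_outcomes f H J)"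

definition given :: "'w measure \<Rightarrow> ('w \<Rightarrow> bool) \<Rightarrow> 'w measure" where
  "given P E = uniform_measure P {\<omega> \<in> space P. E \<omega>}"

definition concat_files :: "nat \<Rightarrow> nat \<Rightarrow> (nat \<Rightarrow> 'a vec) \<Rightarrow> 'a vec" where
  "concat_files f x m = Matrix.vec (f * x) (\<lambda>i. vec_index (m (i div x)) (i mod x))"

definition block_mat :: "nat \<Rightarrow> nat \<Rightarrow> nat \<Rightarrow> 'a :: zero_neq_one mat" where
  "block_mat f x k = Matrix.mat x (f * x) (\<lambda>(i, j). if j = k * x + i then 1 else 0)"

definition spir_query :: "nat \<Rightarrow> 'a :: field mat \<Rightarrow> 'a mat \<Rightarrow> 'a outcome \<Rightarrow> 'a mat" where
  "spir_query f H J \<omega> = J * block_mat f (dim_col J) (Index \<omega>) + H * UserRand \<omega>"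

definition server_query ::
  "nat \<Rightarrow> 'a :: field mat \<Rightarrow> 'a mat \<Rightarrow> (nat \<Rightarrow> nat) \<Rightarrow> nat set \<Rightarrow> 'a outcome \<Rightarrow> 'a mat" where
  "server_query f H J \<tau> X \<omega> = rows_at \<tau> (spir_query f H J \<omega>) X"

definition server_answer ::
  "nat \<Rightarrow> 'a :: field mat \<Rightarrow> 'a mat \<Rightarrow> (nat \<Rightarrow> nat) \<Rightarrow> nat \<Rightarrow> 'a outcome \<Rightarrow> 'a vec" where
  "server_answer f H J \<tau> j \<omega> =
     server_query f H J \<tau> {j} \<omega> *\<^sub>v concat_files f (dim_col J) (Files \<omega>)
     + rows_at \<tau> H {j} *\<^sub>v Seed \<omega>"

text \<open>Tuples \<open>(A\<^sub>i)\<^sub>i\<^sub>\<in>\<^sub>X\<close> are functions restricted to \<open>X\<close>.\<close>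

definition answers ::
  "nat \<Rightarrow> 'a :: field mat \<Rightarrow> 'a mat \<Rightarrow> (nat \<Rightarrow> nat) \<Rightarrow> nat set \<Rightarrow> 'a outcome \<Rightarrow> nat \<Rightarrow> 'a vec" where
  "answers f H J \<tau> X \<omega> = restrict (\<lambda>j. server_answer f H J \<tau> j \<omega>) X"

definition other_files :: "nat \<Rightarrow> nat \<Rightarrow> 'a outcome \<Rightarrow> nat \<Rightarrow> 'a vec" where
  "other_files f k \<omega> = restrict (Files \<omega>) ({..<f} - {k})"

text \<open>Ties between maximisers of the likelihood are broken arbitrarily by \<^const>\<open>arg_max_on\<close>.\<close>

definition ml_decoder ::
  "'w measure \<Rightarrow> 'm set \<Rightarrow> ('w \<Rightarrow> 'm) \<Rightarrow> ('w \<Rightarrow> 'd) \<Rightarrow> 'd \<Rightarrow> 'm" where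
  "ml_decoder P S X Y d = arg_max_on (\<lambda>m. \<P>(\<omega> in P. Y \<omega> = d \<bar> X \<omega> = m)) S"

definition ml_error_prob ::
  "'w measure \<Rightarrow> 'm set \<Rightarrow> ('w \<Rightarrow> 'm) \<Rightarrow> ('w \<Rightarrow> 'd) \<Rightarrow> real" where
  "ml_error_prob P S X Y = \<P>(\<omega> in P. ml_decoder P S X Y (Y \<omega>) \<noteq> X \<omega>)"

definition mutual_info :: "'w measure \<Rightarrow> ('w \<Rightarrow> 'b) \<Rightarrow> ('w \<Rightarrow> 'c) \<Rightarrow> real" where
  "mutual_info P X Y =
     prob_space.mutual_information P 2 (count_space (X ` space P)) (count_space (Y ` space P)) X Y"

definition spir_correct ::
  "nat set set \<Rightarrow> nat \<Rightarrow> 'a :: field mat \<Rightarrow> 'a mat \<Rightarrow> (nat \<Rightarrow> nat) \<Rightarrow> bool" where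
  "spir_correct \<AA> f H J \<tau> \<longleftrightarrow>
     (\<forall>r \<in> carrier_mat (dim_col H) (f * dim_col J). \<forall>k<f. \<forall>A\<in>\<AA>.
        ml_error_prob (given (spir_space f H J) (\<lambda>\<omega>. Index \<omega> = k \<and> UserRand \<omega> = r))
          (carrier_vec (dim_col J)) (\<lambda>\<omega>. Files \<omega> k) (answers f H J \<tau> A) = 0)"

definition server_secret ::
  "nat \<Rightarrow> nat \<Rightarrow> 'a :: field mat \<Rightarrow> 'a mat \<Rightarrow> (nat \<Rightarrow> nat) \<Rightarrow> bool" where
  "server_secret n f H J \<tau> \<longleftrightarrow>
     (\<forall>r \<in> carrier_mat (dim_col H) (f * dim_col J). \<forall>k<f.
        mutual_info (given (spir_space f H J) (\<lambda>\<omega>. UserRand \<omega> = r \<and> Index \<omega> = k))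
          (answers f H J \<tau> {..<n}) (other_files f k) = 0)"

definition user_secret ::
  "nat set set \<Rightarrow> nat \<Rightarrow> 'a :: field mat \<Rightarrow> 'a mat \<Rightarrow> (nat \<Rightarrow> nat) \<Rightarrow> bool" where
  "user_secret \<BB> f H J \<tau> \<longleftrightarrow>
     (\<forall>B\<in>\<BB>. mutual_info (spir_space f H J) Index (server_query f H J \<tau> B) = 0)"

definition is_csspir ::
  "nat set set \<Rightarrow> nat set set \<Rightarrow> nat \<Rightarrow> nat \<Rightarrow> 'a :: {field, finite} mat \<Rightarrow> 'a mat \<Rightarrow> (nat \<Rightarrow> nat) \<Rightarrow> bool"
  where
  "is_csspir \<AA> \<BB> n f H J \<tau> \<longleftrightarrow>
     spir_description n H J \<tau> \<and>
     spir_correct \<AA> f H J \<tau> \<and> server_secret n f H J \<tau> \<and> user_secret \<BB> f H J \<tau>"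

definition pir_rate :: "nat \<Rightarrow> 'a mat \<Rightarrow> (nat \<Rightarrow> nat) \<Rightarrow> real" where
  "pir_rate n J \<tau> =
     log 2 (card (carrier_vec (dim_col J) :: 'a vec set)) /
     (\<Sum>j<n. log 2 (card (carrier_vec (card {i. i < dim_row J \<and> \<tau> i = j}) :: 'a vec set)))"

definition shared_randomness_rate :: "'a mat \<Rightarrow> 'a mat \<Rightarrow> real" where
  "shared_randomness_rate H J =
     log 2 (card (carrier_vec (dim_col H) :: 'a vec set)) /
     log 2 (card (carrier_vec (dim_col J) :: 'a vec set))"

end

theory Submission
  imports Defs
begin

text \<open>
  Given \<open>K = k\<close> and \<open>R = r\<close>, server \<open>j\<close> answers \<open>G\<^sub>j (M\<^sub>k, r M + U)\<close>, where \<open>G\<^sub>j\<close> consists of its rows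
  of \<open>G = (G', G'')\<close>. Acceptance lets an accepted set recover each coordinate of \<open>M\<^sub>k\<close> as a linear
  combination of its answers. Changing the other files while compensating in \<open>U\<close> leaves all answers
  fixed, which is server secrecy. Rejection of \<open>B\<close> says that the left kernel of \<open>G''\<^sub>B\<close> lies in that
  of \<open>G'\<^sub>B\<close>, hence \<open>G'\<^sub>B = G''\<^sub>B S\<close> for some \<open>S\<close>, and \<open>B\<close> sees \<open>G''\<^sub>B (S E\<^sub>k + R)\<close>; changing the index
  while compensating in \<open>R\<close> gives user secrecy.
\<close>

unbundle no inner_syntax and no vec_syntax

section \<open>Solvability of linear systems and factorization of matrices\<close>

text \<open>Induction on \<open>n\<close>. A functional \<open>c\<close> that kills the first
  \<open>n\<close> vectors but not \<open>b\<close> either kills \<open>v n\<close> too, and is then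
  the required certificate, or it dictates the coefficient of \<open>v n\<close>; subtracting that
  multiple of \<open>v n\<close> from \<open>b\<close> leaves a system with \<open>n\<close>
  vectors.\<close>

lemma fredholm_alternative:
  fixes v :: "nat \<Rightarrow> 'i \<Rightarrow> 'a :: field"
  assumes "finite I"
  shows "(\<exists>s. \<forall>i\<in>I. b i = (\<Sum>j<n. s j * v j i)) \<or>
    (\<exists>c. (\<forall>j<n. (\<Sum>i\<in>I. c i * v j i) = 0) \<and> (\<Sum>i\<in>I. c i * b i) \<noteq> 0)"
proof (induction n arbitrary: b)
  case 0
  show ?case
  proof (cases "\<forall>i\<in>I. b i = 0")
    case False
    then obtain i where i: "i \<in> I" "b i \<noteq> 0" by blast
    have "(\<Sum>l\<in>I. (if l = i then 1 else 0) * b l) = (\<Sum>l\<in>I. if i = l then b l else 0)"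
      by (rule sum.cong) auto
    also have "\<dots> = b i" using i assms by simp
    finally show ?thesis
      using i by (intro disjI2 exI[of _ "\<lambda>l. if l = i then 1 else 0"]) simp
  qed simp
next
  case (Suc n)
  let ?dot = "\<lambda>c b. \<Sum>i\<in>I. c i * b i"
  show ?case
  proof (rule disjCI)
    assume no: "\<not> (\<exists>c. (\<forall>j<Suc n. ?dot c (v j) = 0) \<and> ?dot c b \<noteq> 0)"
    show "\<exists>s. \<forall>i\<in>I. b i = (\<Sum>j<Suc n. s j * v j i)"
    proof (cases "\<exists>s. \<forall>i\<in>I. b i = (\<Sum>j<n. s j * v j i)")
      case True
      then obtain s where "\<forall>i\<in>I. b i = (\<Sum>j<n. s j * v j i)" by blast
      then show ?thesis by (intro exI[of _ "s(n := 0)"]) simp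
    next
      case False
      then obtain c where c: "\<forall>j<n. ?dot c (v j) = 0" "?dot c b \<noteq> 0"
        using Suc.IH[of b] by blast
      have cw: "?dot c (v n) \<noteq> 0" using no c less_antisym by blast
      \<comment> \<open>Applying \<open>c\<close> to an expansion of \<open>b\<close> in the
        \<open>Suc n\<close> vectors leaves only the last term, so \<open>t\<close> is the only
        possible coefficient of \<open>v n\<close>.\<close>
      define t where "t = ?dot c b / ?dot c (v n)"
      define b' where "b' i = b i - t * v n i" for i
      have "\<exists>s. \<forall>i\<in>I. b' i = (\<Sum>j<n. s j * v j i)"
      proof (rule ccontr)
        assume "\<not> ?thesis"
        then obtain d where d: "\<forall>j<n. ?dot d (v j) = 0" "?dot d b' \<noteq> 0"
          using Suc.IH[of b'] by blast
        \<comment> \<open>The correction by \<open>r\<close> makes \<open>d - r c\<close> kill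
          \<open>v n\<close> as well, while its value at \<open>b\<close> is that of
          \<open>d\<close> at \<open>b'\<close>, hence nonzero.\<close>
        define r where "r = ?dot d (v n) / ?dot c (v n)"
        have e: "?dot (\<lambda>i. d i - r * c i) w = ?dot d w - r * ?dot c w" for w
          by (simp add: left_diff_distrib sum_subtractf sum_distrib_left mult.assoc)
        have "?dot d b' = ?dot d b - t * ?dot d (v n)"
          by (simp add: b'_def right_diff_distrib sum_subtractf sum_distrib_left mult.left_commute)
        moreover have "r * ?dot c b = t * ?dot d (v n)" by (simp add: r_def t_def)
        ultimately have "?dot (\<lambda>i. d i - r * c i) b \<noteq> 0" using d(2) unfolding e by simp
        moreover have "?dot (\<lambda>i. d i - r * c i) (v j) = 0" if "j < Suc n" for j
        proof (cases "j = n")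
          case True
          then show ?thesis unfolding e using cw by (simp add: r_def)
        next
          case False
          then show ?thesis unfolding e using c(1) d(1) that by simp
        qed
        ultimately have "\<exists>c. (\<forall>j<Suc n. ?dot c (v j) = 0) \<and> ?dot c b \<noteq> 0"
          by (intro exI[of _ "\<lambda>i. d i - r * c i"] conjI allI impI)
        with no show False by contradiction
      qed
      then obtain s where s: "\<forall>i\<in>I. b' i = (\<Sum>j<n. s j * v j i)" by blast
      have "b i = (\<Sum>j<Suc n. (s(n := t)) j * v j i)" if "i \<in> I" for i
        using s that by (simp add: b'_def diff_eq_eq)
      then show ?thesis by (intro exI[of _ "s(n := t)"] ballI)
    qed
  qed
qed

lemma transpose_mult_vec_index:
  fixes A :: "'a :: comm_semiring_0 mat"
  assumes "A \<in> carrier_mat m n" "j < n"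
  shows "(A\<^sup>T *\<^sub>v Matrix.vec m c) $ j = (\<Sum>i<m. c i * A $$ (i, j))"
  using assms by (simp add: scalar_prod_def atLeast0LessThan mult.commute)

text \<open>The system is solved one column of \<open>J\<close> at a time. A certificate of
  unsolvability for column \<open>k\<close> would be a vector in the left kernel of \<open>H\<close>
  whose product with column \<open>k\<close> of \<open>J\<close> is nonzero, which
  \<open>ker\<close> forbids. The solutions are the columns of \<open>S\<close>.\<close>

lemma mat_factor_through:
  fixes H J :: "'a :: field mat"
  assumes H: "H \<in> carrier_mat m y" and J: "J \<in> carrier_mat m x"
    and ker: "\<And>c. c \<in> carrier_vec m \<Longrightarrow> H\<^sup>T *\<^sub>v c = 0\<^sub>v y \<Longrightarrow> J\<^sup>T *\<^sub>v c = 0\<^sub>v x"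
  shows "\<exists>S\<in>carrier_mat y x. J = H * S"
proof -
  have "\<exists>s. \<forall>i\<in>{..<m}. J $$ (i, k) = (\<Sum>j<y. s j * H $$ (i, j))" if k: "k < x" for k
  proof (rule ccontr)
    assume "\<not> ?thesis"
    then obtain c where c: "\<forall>j<y. (\<Sum>i<m. c i * H $$ (i, j)) = 0" "(\<Sum>i<m. c i * J $$ (i, k)) \<noteq> 0"
      using fredholm_alternative[where I = "{..<m}" and b = "\<lambda>i. J $$ (i, k)" and n = y
          and v = "\<lambda>j i. H $$ (i, j)"] by auto
    have "H\<^sup>T *\<^sub>v Matrix.vec m c = 0\<^sub>v y"
    proof (rule eq_vecI)
      fix j assume "j < dim_vec (0\<^sub>v y :: 'a vec)"
      then have j: "j < y" by simp
      then show "(H\<^sup>T *\<^sub>v Matrix.vec m c) $ j = 0\<^sub>v y $ j"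
        using c(1) by (simp only: transpose_mult_vec_index[OF H j] index_zero_vec)
    qed (use H in simp)
    then have "J\<^sup>T *\<^sub>v Matrix.vec m c = 0\<^sub>v x" using ker by simp
    then have "(J\<^sup>T *\<^sub>v Matrix.vec m c) $ k = 0" using k by simp
    then show False
      using c(2) by (simp only: transpose_mult_vec_index[OF J k])
  qed
  then obtain s where s: "\<And>k i. k < x \<Longrightarrow> i < m \<Longrightarrow> J $$ (i, k) = (\<Sum>j<y. s k j * H $$ (i, j))"
    by (metis lessThan_iff)
  have "J = H * Matrix.mat y x (\<lambda>(j, k). s k j)"
  proof (rule eq_matI)
    fix i k assume "i < dim_row (H * Matrix.mat y x (\<lambda>(j, k). s k j))"
      "k < dim_col (H * Matrix.mat y x (\<lambda>(j, k). s k j))"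
    then have i: "i < m" and k: "k < x" using H by simp_all
    show "J $$ (i, k) = (H * Matrix.mat y x (\<lambda>(j, k). s k j)) $$ (i, k)"
      unfolding s[OF k i] using H i k
      by (simp add: scalar_prod_def atLeast0LessThan mult.commute)
  qed (use H J in simp_all)
  moreover have "Matrix.mat y x (\<lambda>(j, k). s k j) \<in> carrier_mat y x" by simp
  ultimately show ?thesis by blast
qed

section \<open>Concatenated matrices and selection of rows\<close>

lemma dim_hcat [simp]:
  "dim_row (hcat A B) = dim_row A" "dim_col (hcat A B) = dim_col A + dim_col B"
  by (simp_all add: hcat_def)

lemma hcat_carrier:
  assumes "A \<in> carrier_mat m x" "B \<in> carrier_mat m y"
  shows "hcat A B \<in> carrier_mat m (x + y)"
  using assms by (intro carrier_matI) simp_all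

lemma hcat_index:
  assumes "A \<in> carrier_mat m x" "B \<in> carrier_mat m y" "i < m" "j < x + y"
  shows "hcat A B $$ (i, j) = (if j < x then A $$ (i, j) else B $$ (i, j - x))"
  using assms by (simp add: hcat_def)

lemma hcat_row:
  assumes A: "A \<in> carrier_mat m x" and B: "B \<in> carrier_mat m y" and i: "i < m"
  shows "Matrix.row (hcat A B) i = Matrix.row A i @\<^sub>v Matrix.row B i"
proof (rule eq_vecI)
  fix j assume "j < dim_vec (Matrix.row A i @\<^sub>v Matrix.row B i)"
  then have j: "j < x + y" using A B by simp
  then show "Matrix.row (hcat A B) i $ j = (Matrix.row A i @\<^sub>v Matrix.row B i) $ j"
    using A B i by (simp add: hcat_index[OF A B i j])
qed (use A B in simp)

lemma hcat_col:
  assumes A: "A \<in> carrier_mat m x" and B: "B \<in> carrier_mat m y" and j: "j < x + y"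
  shows "Matrix.col (hcat A B) j = (if j < x then Matrix.col A j else Matrix.col B (j - x))"
proof (rule eq_vecI)
  fix i assume "i < dim_vec (if j < x then Matrix.col A j else Matrix.col B (j - x))"
  then have i: "i < m" using A B by (simp split: if_splits)
  then show "Matrix.col (hcat A B) j $ i = (if j < x then Matrix.col A j else Matrix.col B (j - x)) $ i"
    using A B j by (simp add: hcat_index[OF A B i j])
qed (use A B in simp)

lemma hcat_mult_append:
  fixes A B :: "'a :: field mat"
  assumes A: "A \<in> carrier_mat m x" and B: "B \<in> carrier_mat m y"
    and u: "u \<in> carrier_vec x" and w: "w \<in> carrier_vec y"
  shows "hcat A B *\<^sub>v (u @\<^sub>v w) = A *\<^sub>v u + B *\<^sub>v w"
proof (rule eq_vecI)
  fix i assume "i < dim_vec (A *\<^sub>v u + B *\<^sub>v w)"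
  then have i: "i < m" using B by simp
  show "(hcat A B *\<^sub>v (u @\<^sub>v w)) $ i = (A *\<^sub>v u + B *\<^sub>v w) $ i"
    using A B i scalar_prod_append[OF _ _ u w, of "Matrix.row A i" "Matrix.row B i"]
    by (simp add: hcat_row[OF A B i])
qed (use A B in simp)

lemma hcat_transpose_mult:
  fixes A B :: "'a :: field mat"
  assumes A: "A \<in> carrier_mat m x" and B: "B \<in> carrier_mat m y" and c: "c \<in> carrier_vec m"
  shows "(hcat A B)\<^sup>T *\<^sub>v c = (A\<^sup>T *\<^sub>v c) @\<^sub>v (B\<^sup>T *\<^sub>v c)"
proof (rule eq_vecI)
  fix j assume "j < dim_vec ((A\<^sup>T *\<^sub>v c) @\<^sub>v (B\<^sup>T *\<^sub>v c))"
  then have j: "j < x + y" using A B by simp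
  show "((hcat A B)\<^sup>T *\<^sub>v c) $ j = ((A\<^sup>T *\<^sub>v c) @\<^sub>v (B\<^sup>T *\<^sub>v c)) $ j"
    using A B j by (simp add: hcat_col[OF A B j])
qed (use A B in simp)

lemma dim_rows_at [simp]:
  "dim_row (rows_at \<tau> A X) = card {i. i < dim_row A \<and> \<tau> i \<in> X}"
  "dim_col (rows_at \<tau> A X) = dim_col A"
  by (auto simp: rows_at_def dim_submatrix intro!: arg_cong[where f=card])

lemma rows_at_carrier:
  assumes "A \<in> carrier_mat z m"
  shows "rows_at \<tau> A X \<in> carrier_mat (card {i. i < z \<and> \<tau> i \<in> X}) m"
  using assms by (intro carrier_matI) simp_all

lemma rows_at_index:
  assumes "a < card {i. i < dim_row A \<and> \<tau> i \<in> X}" "j < dim_col A"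
  shows "rows_at \<tau> A X $$ (a, j) = A $$ (pick {i. i < dim_row A \<and> \<tau> i \<in> X} a, j)"
proof -
  \<comment> \<open>\<open>submatrix\<close> intersects its index set with the row range once more;
    the set used in \<open>rows_at\<close> already lies in that range.\<close>
  have "{i. i < dim_row A \<and> i \<in> {i. i < dim_row A \<and> \<tau> i \<in> X}} = {i. i < dim_row A \<and> \<tau> i \<in> X}"
    by auto
  then show ?thesis using assms unfolding rows_at_def by (subst submatrix_index) (auto simp: pick_UNIV)
qed

lemma pick_rows:
  assumes "a < card {i. i < z \<and> \<tau> i \<in> X}"
  shows "pick {i. i < z \<and> \<tau> i \<in> X} a < z" "\<tau> (pick {i. i < z \<and> \<tau> i \<in> X} a) \<in> X"
  using pick_in_set_le[OF assms] by auto

lemma row_rows_at: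
  assumes "a < card {i. i < dim_row A \<and> \<tau> i \<in> X}"
  shows "Matrix.row (rows_at \<tau> A X) a = Matrix.row A (pick {i. i < dim_row A \<and> \<tau> i \<in> X} a)"
  using assms pick_rows[OF assms]
  by (intro eq_vecI) (auto simp: rows_at_index)

lemma rows_at_mult:
  fixes A B :: "'a :: field mat"
  assumes "dim_col A = dim_row B"
  shows "rows_at \<tau> (A * B) X = rows_at \<tau> A X * B"
proof (rule eq_matI)
  fix i j assume ij: "i < dim_row (rows_at \<tau> A X * B)" "j < dim_col (rows_at \<tau> A X * B)"
  have i: "i < card {i. i < dim_row A \<and> \<tau> i \<in> X}" using ij(1) by simp
  then show "rows_at \<tau> (A * B) X $$ (i, j) = (rows_at \<tau> A X * B) $$ (i, j)"
    using ij pick_rows[OF i] by (simp add: rows_at_index row_rows_at)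
qed simp_all

lemma rows_at_add:
  fixes A B :: "'a :: field mat"
  assumes "dim_row A = dim_row B" "dim_col A = dim_col B"
  shows "rows_at \<tau> (A + B) X = rows_at \<tau> A X + rows_at \<tau> B X"
proof (rule eq_matI)
  fix i j assume ij: "i < dim_row (rows_at \<tau> A X + rows_at \<tau> B X)"
    "j < dim_col (rows_at \<tau> A X + rows_at \<tau> B X)"
  have i: "i < card {i. i < dim_row B \<and> \<tau> i \<in> X}" using ij(1) by simp
  then show "rows_at \<tau> (A + B) X $$ (i, j) = (rows_at \<tau> A X + rows_at \<tau> B X) $$ (i, j)"
    using ij pick_rows[OF i] assms by (auto simp: rows_at_index)
qed (use assms in simp_all)

lemma rows_at_hcat:
  assumes A: "A \<in> carrier_mat z x" and B: "B \<in> carrier_mat z y"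
  shows "rows_at \<tau> (hcat A B) X = hcat (rows_at \<tau> A X) (rows_at \<tau> B X)"
proof -
  note r = rows_at_carrier[OF A, of \<tau> X] rows_at_carrier[OF B, of \<tau> X]
    rows_at_carrier[OF hcat_carrier[OF A B], of \<tau> X]
  have d: "dim_row A = z" "dim_row B = z" "dim_col A = x" "dim_col B = y" using A B by auto
  show ?thesis
  proof (rule eq_matI)
    fix i j assume "i < dim_row (hcat (rows_at \<tau> A X) (rows_at \<tau> B X))"
      "j < dim_col (hcat (rows_at \<tau> A X) (rows_at \<tau> B X))"
    then have ij: "i < card {i. i < z \<and> \<tau> i \<in> X}" "j < x + y"
      using d by auto
    then show "rows_at \<tau> (hcat A B) X $$ (i, j) = hcat (rows_at \<tau> A X) (rows_at \<tau> B X) $$ (i, j)"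
      using A B d pick_rows[OF ij(1)]
      by (simp add: rows_at_index hcat_index[OF A B] hcat_index[OF r(1,2) ij])
  qed (use d in auto)
qed

text \<open>Reduces equality of products to single rows, so that equalities for individual servers
  combine into one for a whole set of servers without comparing the orders in which the rows are
  listed.\<close>

lemma rows_at_mult_vec_eq_iff:
  fixes A :: "'a :: field mat"
  shows "rows_at \<tau> A X *\<^sub>v u = rows_at \<tau> A X *\<^sub>v w \<longleftrightarrow>
    (\<forall>i<dim_row A. \<tau> i \<in> X \<longrightarrow> Matrix.row A i \<bullet> u = Matrix.row A i \<bullet> w)"
    (is "?L \<longleftrightarrow> ?R")
proof
  let ?I = "{i. i < dim_row A \<and> \<tau> i \<in> X}"
  {
    assume L: ?L
    show ?R
    proof (intro allI impI)
      fix i assume i: "i < dim_row A" "\<tau> i \<in> X"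
      \<comment> \<open>The position of row \<open>i\<close> in the submatrix is the number of
        selected rows before it, as \<open>pick\<close> counts from zero.\<close>
      define a where "a = card {l \<in> ?I. l < i}"
      have p: "pick ?I a = i" unfolding a_def using i by (intro pick_card_in_set) auto
      have "{l \<in> ?I. l < i} \<subset> ?I" using i by blast
      then have a: "a < card ?I" unfolding a_def by (intro psubset_card_mono) auto
      have "(rows_at \<tau> A X *\<^sub>v u) $ a = (rows_at \<tau> A X *\<^sub>v w) $ a" using L by simp
      then show "Matrix.row A i \<bullet> u = Matrix.row A i \<bullet> w" using a p by (simp add: row_rows_at)
    qed
  next
    assume R: ?R
    show ?L
    proof (rule eq_vecI)
      fix a assume "a < dim_vec (rows_at \<tau> A X *\<^sub>v w)"
      then have a: "a < card ?I" by simp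
      then show "(rows_at \<tau> A X *\<^sub>v u) $ a = (rows_at \<tau> A X *\<^sub>v w) $ a"
        using R pick_rows[OF a] by (simp add: row_rows_at)
    qed simp
  }
qed

section \<open>Consequences of acceptance and rejection\<close>

text \<open>Acceptance writes the unit vector of index \<open>i\<close> as a combination
  \<open>c\<close> of the rows held by \<open>A\<close>. Coordinate \<open>i\<close> of any vector
  is then the scalar product of \<open>c\<close> with the image of that vector under these rows, so
  the image determines it.\<close>

lemma accepts_determines:
  fixes G :: "'a :: field mat"
  assumes G: "G \<in> carrier_mat z (x + y)" and acc: "accepts x y G \<tau> \<AA>" and A: "A \<in> \<AA>"
    and u: "u \<in> carrier_vec (x + y)" and w: "w \<in> carrier_vec (x + y)"
    and eq: "\<And>j. j \<in> A \<Longrightarrow> rows_at \<tau> G {j} *\<^sub>v u = rows_at \<tau> G {j} *\<^sub>v w"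
    and i: "i < x"
  shows "u $ i = w $ i"
proof -
  have eqA: "rows_at \<tau> G A *\<^sub>v u = rows_at \<tau> G A *\<^sub>v w"
    using eq unfolding rows_at_mult_vec_eq_iff by blast
  let ?A = "rows_at \<tau> G A"
  note GA = rows_at_carrier[OF G, of \<tau> A]
  have "unit_vec (x + y) i \<in> vec_space.row_space (x + y) ?A"
    using acc A i unfolding accepts_def target_vecs_def by blast
  then obtain c where c: "c \<in> carrier_vec (dim_row ?A)" "?A\<^sup>T *\<^sub>v c = unit_vec (x + y) i"
    unfolding vec_space.row_space_eq[OF GA] by blast
  \<comment> \<open>The vector \<open>c\<close> is fixed before \<open>v\<close>: one linear decoder
    serves both \<open>u\<close> and \<open>w\<close>.\<close>
  have "v $ i = c \<bullet> (?A *\<^sub>v v)" if v: "v \<in> carrier_vec (x + y)" for v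
  proof -
    have "v $ i = unit_vec (x + y) i \<bullet> v" using v i by simp
    also have "\<dots> = c \<bullet> (?A *\<^sub>v v)"
      unfolding c(2)[symmetric]
      using GA v c(1) unfolding carrier_matD(1)[OF GA] by (rule transpose_vec_mult_scalar)
    finally show ?thesis .
  qed
  from this[OF u] this[OF w] show ?thesis unfolding eqA by (rule trans[OF _ sym])
qed

text \<open>The span of the targets is the column space of \<open>?T\<close>, an identity block over
  a zero block, and \<open>?T\<close> sends \<open>w\<close> to \<open>w\<close> padded by zeros.
  Membership thus follows from \<open>col_space_eq\<close>.\<close>

lemma span_target_vecs:
  "w \<in> carrier_vec x \<Longrightarrow> (w @\<^sub>v 0\<^sub>v y :: 'a :: field vec)
    \<in> LinearCombinations.module.span class_ring (module_vec TYPE('a) (x + y)) (target_vecs x y)"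
proof -
  assume w: "w \<in> carrier_vec x"
  interpret vec_space "TYPE('a)" "x + y" .
  let ?T = "Matrix.mat (x + y) x (\<lambda>(i, j). if i = j then 1 else 0) :: 'a mat"
  have "Matrix.col ?T j = unit_vec (x + y) j" if "j < x" for j
    using that by (intro eq_vecI) auto
  then have T: "set (cols ?T) = target_vecs x y"
    by (auto simp: cols_def target_vecs_def)
  have "w @\<^sub>v 0\<^sub>v y = ?T *\<^sub>v w"
  proof (rule eq_vecI)
    fix i assume "i < dim_vec (?T *\<^sub>v w)"
    then have i: "i < x + y" by simp
    have "(?T *\<^sub>v w) $ i = (\<Sum>j\<in>{0..<x}. if i = j then w $ j else 0)"
    proof (subst index_mult_mat_vec)
      show "Matrix.row ?T i \<bullet> w = (\<Sum>j\<in>{0..<x}. if i = j then w $ j else 0)"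
        unfolding scalar_prod_def using i w by (intro sum.cong) auto
    qed (use i in simp)
    then show "(w @\<^sub>v 0\<^sub>v y) $ i = (?T *\<^sub>v w) $ i" using i w by auto
  qed (use w in simp)
  moreover have "?T *\<^sub>v w \<in> carrier_vec (x + y)"
    using w by (intro mult_mat_vec_carrier[of _ _ x]) simp_all
  then have "?T *\<^sub>v w \<in> col_space ?T"
    by (subst col_space_eq[of _ x]) (simp, intro CollectI conjI bexI[of _ w], use w in simp_all)
  ultimately show ?thesis unfolding col_space_def T by simp
qed

text \<open>Let \<open>c\<close> be in the left kernel of the selected rows of \<open>H\<close>. It
  combines the rows of the concatenated matrix to a vector whose last \<open>y\<close> entries
  vanish, which lies both in the row space and in the span of the targets. Rejection makes it zero,
  so \<open>c\<close> is also in the left kernel of the selected rows of \<open>J\<close>.\<close>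

lemma rejects_factor:
  fixes J H :: "'a :: field mat"
  assumes J: "J \<in> carrier_mat z x" and H: "H \<in> carrier_mat z y"
    and rej: "rejects x y (hcat J H) \<tau> \<BB>" and B: "B \<in> \<BB>"
  shows "\<exists>S\<in>carrier_mat y x. rows_at \<tau> J B = rows_at \<tau> H B * S"
proof (rule mat_factor_through)
  note r = rows_at_carrier[OF J, of \<tau> B] rows_at_carrier[OF H, of \<tau> B]
    rows_at_carrier[OF hcat_carrier[OF J H], of \<tau> B]
  show "rows_at \<tau> H B \<in> carrier_mat (card {i. i < z \<and> \<tau> i \<in> B}) y"
    "rows_at \<tau> J B \<in> carrier_mat (card {i. i < z \<and> \<tau> i \<in> B}) x" using r by auto
  fix c :: "'a vec"
  assume c: "c \<in> carrier_vec (card {i. i < z \<and> \<tau> i \<in> B})" "(rows_at \<tau> H B)\<^sup>T *\<^sub>v c = 0\<^sub>v y"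
  let ?w = "(rows_at \<tau> J B)\<^sup>T *\<^sub>v c"
  have w: "?w \<in> carrier_vec x" using r c by auto
  have "(rows_at \<tau> (hcat J H) B)\<^sup>T *\<^sub>v c = ?w @\<^sub>v 0\<^sub>v y"
    unfolding rows_at_hcat[OF J H] using hcat_transpose_mult[OF r(1,2) c(1)] c(2) by simp
  then have "?w @\<^sub>v 0\<^sub>v y \<in> vec_space.row_space (x + y) (rows_at \<tau> (hcat J H) B)"
    unfolding vec_space.row_space_eq[OF r(3)] using r(3) c(1) w
    by (intro CollectI conjI bexI[of _ c]) (simp_all only: carrier_matD append_carrier_vec zero_carrier_vec)
  then have "?w @\<^sub>v 0\<^sub>v y = 0\<^sub>v (x + y)"
    using rej B span_target_vecs[OF w, of y] unfolding rejects_def by blast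
  also have "\<dots> = 0\<^sub>v x @\<^sub>v 0\<^sub>v y" by auto
  finally show "?w = 0\<^sub>v x" using w by (metis append_vec_eq zero_carrier_vec)
qed

section \<open>Queries and answers of the protocol\<close>

lemma block_mat_mult_concat_files:
  fixes m :: "nat \<Rightarrow> 'a :: field vec"
  assumes "k < f" "m k \<in> carrier_vec x"
  shows "block_mat f x k *\<^sub>v concat_files f x m = m k"
proof (rule eq_vecI)
  fix i assume "i < dim_vec (m k)"
  then have i: "i < x" using assms by simp
  have "k * x + i < k * x + x" using i by simp
  also have "\<dots> = Suc k * x" by simp
  also have "\<dots> \<le> f * x" using assms by (intro mult_right_mono) auto
  finally have ki: "k * x + i < f * x" .
  have "(block_mat f x k *\<^sub>v concat_files f x m) $ i =
      (\<Sum>j\<in>{0..<f * x}. if k * x + i = j then m (j div x) $ (j mod x) else 0)"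
  proof (subst index_mult_mat_vec)
    show "Matrix.row (block_mat f x k) i \<bullet> concat_files f x m =
        (\<Sum>j\<in>{0..<f * x}. if k * x + i = j then m (j div x) $ (j mod x) else 0)"
      unfolding scalar_prod_def block_mat_def concat_files_def using i by (intro sum.cong) auto
  qed (use i in \<open>simp add: block_mat_def\<close>)
  \<comment> \<open>Only the index \<open>k * x + i\<close> survives; as \<open>i < x\<close>, its
    quotient by \<open>x\<close> is \<open>k\<close> and its remainder is \<open>i\<close>.\<close>
  also have "\<dots> = m k $ i" using ki i by simp
  finally show "(block_mat f x k *\<^sub>v concat_files f x m) $ i = m k $ i" .
qed (use assms in \<open>simp add: block_mat_def\<close>)

lemma concat_files_carrier [simp]: "concat_files f x m \<in> carrier_vec (f * x)"
  by (simp add: concat_files_def)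

lemma block_mat_carrier [simp]: "block_mat f x k \<in> carrier_mat x (f * x)"
  by (simp add: block_mat_def)

lemma server_query_eq:
  fixes H J :: "'a :: field mat"
  assumes J: "J \<in> carrier_mat z x" and H: "H \<in> carrier_mat z y"
    and \<omega>: "\<omega> \<in> spir_outcomes f H J"
  shows "server_query f H J \<tau> X \<omega> =
    rows_at \<tau> J X * block_mat f x (Index \<omega>) + rows_at \<tau> H X * UserRand \<omega>"
proof -
  have R: "UserRand \<omega> \<in> carrier_mat y (f * x)" using \<omega> J H by (auto simp: spir_outcomes_def)
  have "dim_col (block_mat f x (Index \<omega>) :: 'a mat) = f * x"
    "dim_row (block_mat f x (Index \<omega>) :: 'a mat) = x"
    by (simp_all add: block_mat_def)
  then show ?thesis unfolding server_query_def spir_query_def using J H R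
    by (subst rows_at_add) (auto simp: rows_at_mult)
qed

text \<open>The block matrix reduces the part of the answer with \<open>J\<close> to the requested
  file, and the two terms with \<open>H\<close> merge. All other files therefore enter only through
  the second component, where the seed masks them.\<close>

lemma server_answer_eq:
  fixes H J :: "'a :: field mat"
  assumes J: "J \<in> carrier_mat z x" and H: "H \<in> carrier_mat z y"
    and \<omega>: "\<omega> \<in> spir_outcomes f H J"
  shows "server_answer f H J \<tau> j \<omega> = rows_at \<tau> (hcat J H) {j} *\<^sub>v
    (Files \<omega> (Index \<omega>) @\<^sub>v (UserRand \<omega> *\<^sub>v concat_files f x (Files \<omega>) + Seed \<omega>))"
proof -
  have R: "UserRand \<omega> \<in> carrier_mat y (f * x)" "Seed \<omega> \<in> carrier_vec y" "Index \<omega> < f"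
    "Files \<omega> (Index \<omega>) \<in> carrier_vec x"
    using \<omega> J H by (auto simp: spir_outcomes_def)
  have Jx: "dim_col J = x" using J by simp
  let ?M = "concat_files f x (Files \<omega>)"
  note r = rows_at_carrier[OF J, of \<tau> "{j}"] rows_at_carrier[OF H, of \<tau> "{j}"]
  have M: "?M \<in> carrier_vec (f * x)" by simp
  have E: "block_mat f x (Index \<omega>) \<in> carrier_mat x (f * x)" by simp
  have "server_query f H J \<tau> {j} \<omega> *\<^sub>v ?M =
      rows_at \<tau> J {j} *\<^sub>v (block_mat f x (Index \<omega>) *\<^sub>v ?M) + rows_at \<tau> H {j} *\<^sub>v (UserRand \<omega> *\<^sub>v ?M)"
    unfolding server_query_eq[OF J H \<omega>]
    by (subst add_mult_distrib_mat_vec[OF mult_carrier_mat[OF r(1) E] mult_carrier_mat[OF r(2) R(1)] M])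
      (simp only: assoc_mult_mat_vec[OF r(1) E M] assoc_mult_mat_vec[OF r(2) R(1) M])
  also have "\<dots> = rows_at \<tau> J {j} *\<^sub>v Files \<omega> (Index \<omega>) + rows_at \<tau> H {j} *\<^sub>v (UserRand \<omega> *\<^sub>v ?M)"
    using R by (simp add: block_mat_mult_concat_files)
  finally have q: "server_query f H J \<tau> {j} \<omega> *\<^sub>v ?M = \<dots>" .
  have RM: "UserRand \<omega> *\<^sub>v ?M \<in> carrier_vec y" using R M by auto
  show ?thesis
    unfolding server_answer_def Jx q rows_at_hcat[OF J H]
    using r R RM
    by (subst hcat_mult_append[OF r R(4)])
      (auto simp: mult_add_distrib_mat_vec[OF r(2) RM R(2)]
        intro!: assoc_add_vec[of _ "card {i. i < z \<and> \<tau> i \<in> {j}}"])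
qed

section \<open>Uniform distributions, independence and decoding\<close>

text \<open>The hypothesis \<open>indep\<close> says that the joint law and the product of the
  marginal laws agree on atoms. On a finite space the two measures then coincide, and the mutual
  information is the divergence of a measure from itself.\<close>

lemma measure_eq_indep_mutual_info_zero:
  assumes P: "prob_space P" and fin: "finite (space P)" and sets: "sets P = Pow (space P)"
    and indep: "\<And>a b. measure P {\<omega> \<in> space P. X \<omega> = a \<and> Y \<omega> = b} =
      measure P {\<omega> \<in> space P. X \<omega> = a} * measure P {\<omega> \<in> space P. Y \<omega> = b}"
  shows "mutual_info P X Y = 0"
proof -
  interpret prob_space P by fact
  let ?A = "X ` space P" and ?B = "Y ` space P"
  let ?S = "count_space ?A" and ?T = "count_space ?B"
  \<comment> \<open>For finite ranges the product sigma-algebra is the full power set, so the two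
    laws can be compared on singletons.\<close>
  have prod: "?S \<Otimes>\<^sub>M ?T = count_space (?A \<times> ?B)"
    using fin by (intro pair_measure_countable) (auto intro: countable_finite)
  have meas [measurable]: "X \<in> P \<rightarrow>\<^sub>M ?S" "Y \<in> P \<rightarrow>\<^sub>M ?T"
    "(\<lambda>\<omega>. (X \<omega>, Y \<omega>)) \<in> P \<rightarrow>\<^sub>M count_space (?A \<times> ?B)"
    using sets by (auto simp: measurable_def)
  interpret X: prob_space "distr P ?S X" by (rule prob_space_distr) simp
  interpret Y: prob_space "distr P ?T Y" by (rule prob_space_distr) simp
  interpret XY: pair_prob_space "distr P ?S X" "distr P ?T Y" ..
  have "distr P ?S X \<Otimes>\<^sub>M distr P ?T Y = distr P (?S \<Otimes>\<^sub>M ?T) (\<lambda>\<omega>. (X \<omega>, Y \<omega>))"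
  proof (rule measure_eqI_finite)
    show "sets (distr P ?S X \<Otimes>\<^sub>M distr P ?T Y) = Pow (?A \<times> ?B)"
      by (subst sets_pair_measure_cong[of _ ?S _ ?T]) (simp_all only: prod sets_distr sets_count_space)
    show "sets (distr P (?S \<Otimes>\<^sub>M ?T) (\<lambda>\<omega>. (X \<omega>, Y \<omega>))) = Pow (?A \<times> ?B)"
      by (simp add: prod)
    show "finite (?A \<times> ?B)" using fin by simp
    fix p assume "p \<in> ?A \<times> ?B"
    then obtain a b where p: "p = (a, b)" "a \<in> ?A" "b \<in> ?B" by auto
    have pre: "X -` {a} \<inter> space P = {\<omega> \<in> space P. X \<omega> = a}"
      "Y -` {b} \<inter> space P = {\<omega> \<in> space P. Y \<omega> = b}"
      "(\<lambda>\<omega>. (X \<omega>, Y \<omega>)) -` {(a, b)} \<inter> space P = {\<omega> \<in> space P. X \<omega> = a \<and> Y \<omega> = b}"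
      by auto
    have "emeasure (distr P ?S X \<Otimes>\<^sub>M distr P ?T Y) {p} =
        emeasure (distr P ?S X \<Otimes>\<^sub>M distr P ?T Y) ({a} \<times> {b})" using p by simp
    also have "\<dots> = emeasure (distr P ?S X) {a} * emeasure (distr P ?T Y) {b}"
      using p by (intro Y.emeasure_pair_measure_Times) auto
    also have "\<dots> = ennreal (measure P {\<omega> \<in> space P. X \<omega> = a} * measure P {\<omega> \<in> space P. Y \<omega> = b})"
      using p by (simp add: emeasure_distr pre emeasure_eq_measure ennreal_mult)
    also have "\<dots> = emeasure (distr P (?S \<Otimes>\<^sub>M ?T) (\<lambda>\<omega>. (X \<omega>, Y \<omega>))) {p}"
      using p unfolding indep[symmetric] prod
      by (simp add: emeasure_distr pre emeasure_eq_measure)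
    finally show "emeasure (distr P ?S X \<Otimes>\<^sub>M distr P ?T Y) {p} =
      emeasure (distr P (?S \<Otimes>\<^sub>M ?T) (\<lambda>\<omega>. (X \<omega>, Y \<omega>))) {p}" .
  qed
  then show ?thesis
    unfolding mutual_info_def mutual_information_def
    using XY.KL_same_eq_0 by metis
qed

text \<open>A family of injections between the fibres of \<open>Y\<close> that preserve \<open>X\<close> makes \<open>X\<close> and \<open>Y\<close>
  independent under the uniform distribution on \<open>E\<close>.\<close>

lemma card_indep_if_fibre_injections:
  assumes fin: "finite E"
    and inj: "\<And>b b'. b \<in> Y ` E \<Longrightarrow> b' \<in> Y ` E \<Longrightarrow>
      \<exists>\<phi>. inj_on \<phi> {\<omega> \<in> E. Y \<omega> = b} \<and>
        (\<forall>\<omega>\<in>E. Y \<omega> = b \<longrightarrow> \<phi> \<omega> \<in> E \<and> Y (\<phi> \<omega>) = b' \<and> X (\<phi> \<omega>) = X \<omega>)"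
  shows "card {\<omega> \<in> E. X \<omega> = a \<and> Y \<omega> = b} * card E = card {\<omega> \<in> E. X \<omega> = a} * card {\<omega> \<in> E. Y \<omega> = b}"
proof (cases "b \<in> Y ` E")
  case True
  \<comment> \<open>Used in both directions, this gives all fibres of \<open>Y\<close> the same
    number of outcomes with a given property of \<open>X\<close>. The constantly true property
    \<open>Q\<close> yields the sizes of the fibres themselves.\<close>
  have le: "card {\<omega> \<in> E. Y \<omega> = c \<and> Q (X \<omega>)} \<le> card {\<omega> \<in> E. Y \<omega> = c' \<and> Q (X \<omega>)}"
    if "c \<in> Y ` E" "c' \<in> Y ` E" for c c' Q
  proof -
    obtain \<phi> where \<phi>: "inj_on \<phi> {\<omega> \<in> E. Y \<omega> = c}"
      "\<And>\<omega>. \<omega> \<in> E \<Longrightarrow> Y \<omega> = c \<Longrightarrow> \<phi> \<omega> \<in> E \<and> Y (\<phi> \<omega>) = c' \<and> X (\<phi> \<omega>) = X \<omega>"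
      using inj \<open>c \<in> Y ` E\<close> \<open>c' \<in> Y ` E\<close> by meson
    show ?thesis
      by (rule card_inj_on_le[of \<phi>]) (use \<phi> fin in \<open>auto intro: inj_on_subset\<close>)
  qed
  have total: "card {\<omega> \<in> E. Q (X \<omega>)} = card (Y ` E) * card {\<omega> \<in> E. Y \<omega> = b \<and> Q (X \<omega>)}" for Q
  proof -
    have "card {\<omega> \<in> E. Q (X \<omega>)} = (\<Sum>c\<in>Y ` E. card {\<omega> \<in> {\<omega> \<in> E. Q (X \<omega>)}. Y \<omega> = c})"
      using fin sum.group[of "{\<omega> \<in> E. Q (X \<omega>)}" "Y ` E" Y "\<lambda>_. 1 :: nat"]
      by (simp add: image_mono)
    also have "\<dots> = (\<Sum>c\<in>Y ` E. card {\<omega> \<in> E. Y \<omega> = b \<and> Q (X \<omega>)})"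
    proof (rule sum.cong)
      fix c assume c: "c \<in> Y ` E"
      have "{\<omega> \<in> {\<omega> \<in> E. Q (X \<omega>)}. Y \<omega> = c} = {\<omega> \<in> E. Y \<omega> = c \<and> Q (X \<omega>)}" by auto
      then show "card {\<omega> \<in> {\<omega> \<in> E. Q (X \<omega>)}. Y \<omega> = c} = card {\<omega> \<in> E. Y \<omega> = b \<and> Q (X \<omega>)}"
        using le[OF True c, of Q] le[OF c True, of Q] by simp
    qed simp
    finally show ?thesis by simp
  qed
  \<comment> \<open>Both counts carry the same factor, the number of fibres, so cross-multiplication
    gives the claim.\<close>
  have "card {\<omega> \<in> E. X \<omega> = a} = card (Y ` E) * card {\<omega> \<in> E. X \<omega> = a \<and> Y \<omega> = b}"
    using total[of "\<lambda>t. t = a"] by (simp add: conj_commute)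
  moreover have "card E = card (Y ` E) * card {\<omega> \<in> E. Y \<omega> = b}"
    using total[of "\<lambda>_. True"] by simp
  ultimately show ?thesis by (simp add: mult.commute mult.left_commute)
next
  case False
  then have "{\<omega> \<in> E. X \<omega> = a \<and> Y \<omega> = b} = {}" "{\<omega> \<in> E. Y \<omega> = b} = {}" by auto
  then show ?thesis by (simp only: card.empty mult_zero_left mult_zero_right)
qed

text \<open>One notion covers the unconditioned law and the conditioned ones: \<open>given\<close>
  keeps the whole space and only moves the mass onto the event, so \<open>E\<close> may be smaller
  than \<open>space P\<close>.\<close>

definition uniform_on :: "'w measure \<Rightarrow> 'w set \<Rightarrow> bool" where
  "uniform_on P E \<longleftrightarrow> prob_space P \<and> finite (space P) \<and> sets P = Pow (space P) \<and>
     E \<subseteq> space P \<and> E \<noteq> {} \<and> (\<forall>B \<subseteq> space P. measure P B = card (E \<inter> B) / card E)"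

lemma uniform_on_uniform_count_measure:
  "finite \<Omega> \<Longrightarrow> \<Omega> \<noteq> {} \<Longrightarrow> uniform_on (uniform_count_measure \<Omega>) \<Omega>"
  unfolding uniform_on_def
  by (simp add: prob_space_uniform_count_measure space_uniform_count_measure
      sets_uniform_count_measure measure_uniform_count_measure Int_absorb1)

text \<open>The event is nonempty and so has positive probability; in the conditional probability
  the common denominator \<open>card \<Omega>\<close> cancels.\<close>

lemma uniform_on_given:
  assumes fin: "finite \<Omega>" and ne: "{\<omega> \<in> \<Omega>. Q \<omega>} \<noteq> {}"
  shows "uniform_on (given (uniform_count_measure \<Omega>) Q) {\<omega> \<in> \<Omega>. Q \<omega>}"
proof -
  let ?U = "uniform_count_measure \<Omega>" and ?E = "{\<omega> \<in> \<Omega>. Q \<omega>}"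
  have sp: "space ?U = \<Omega>" "sets ?U = Pow \<Omega>"
    by (simp_all add: space_uniform_count_measure sets_uniform_count_measure)
  have "card ?E > 0" "card \<Omega> > 0" using fin ne by (auto simp: card_gt_0_iff)
  then have E: "emeasure ?U ?E \<noteq> 0" "emeasure ?U ?E \<noteq> \<infinity>"
    using fin ne by (auto simp: emeasure_uniform_count_measure)
  have "measure (uniform_measure ?U ?E) B = card (?E \<inter> B) / card ?E" if B: "B \<subseteq> \<Omega>" for B
  proof -
    have "measure (uniform_measure ?U ?E) B = measure ?U (?E \<inter> B) / measure ?U ?E"
      using B sp by (intro measure_uniform_measure[OF E]) auto
    also have "\<dots> = (card (?E \<inter> B) / card \<Omega>) / (card ?E / card \<Omega>)"
      using fin by (subst (1 2) measure_uniform_count_measure) auto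
    also have "\<dots> = card (?E \<inter> B) / card ?E" using \<open>card \<Omega> > 0\<close> by simp
    finally show ?thesis .
  qed
  then show ?thesis
    unfolding uniform_on_def given_def sp(1)
    using fin ne sp prob_space_uniform_measure[OF E] by auto
qed

text \<open>Division by the square of \<open>card E\<close> turns the identity between natural
  numbers into the product rule for probabilities, so independence can be proved by
  counting.\<close>

lemma uniform_on_mutual_info_zero:
  assumes U: "uniform_on P E"
    and indep: "\<And>a b. card {\<omega> \<in> E. X \<omega> = a \<and> Y \<omega> = b} * card E =
      card {\<omega> \<in> E. X \<omega> = a} * card {\<omega> \<in> E. Y \<omega> = b}"
  shows "mutual_info P X Y = 0"
proof (rule measure_eq_indep_mutual_info_zero)
  fix a b
  have m: "measure P {\<omega> \<in> space P. Q \<omega>} = card {\<omega> \<in> E. Q \<omega>} / card E" for Q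
  proof -
    have "E \<inter> {\<omega> \<in> space P. Q \<omega>} = {\<omega> \<in> E. Q \<omega>}" using U by (auto simp: uniform_on_def)
    then show ?thesis using U unfolding uniform_on_def by simp
  qed
  have "card E > 0" using U by (auto simp: uniform_on_def card_gt_0_iff intro: finite_subset)
  then show "measure P {\<omega> \<in> space P. X \<omega> = a \<and> Y \<omega> = b} =
      measure P {\<omega> \<in> space P. X \<omega> = a} * measure P {\<omega> \<in> space P. Y \<omega> = b}"
    unfolding m using indep[of a b, THEN arg_cong[where f = real]] by (simp add: field_simps)
qed (use U in \<open>auto simp: uniform_on_def\<close>)

text \<open>For a value of \<open>Y\<close> observed on \<open>E\<close>, the true message is the
  only one of positive likelihood, hence the unique maximiser that \<open>arg_max_on\<close> must
  return.\<close>

lemma ml_error_prob_zero: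
  assumes U: "uniform_on P E" and S: "\<And>\<omega>. \<omega> \<in> E \<Longrightarrow> X \<omega> \<in> S"
    and det: "\<And>\<omega> \<omega>'. \<omega> \<in> E \<Longrightarrow> \<omega>' \<in> E \<Longrightarrow> Y \<omega> = Y \<omega>' \<Longrightarrow> X \<omega> = X \<omega>'"
  shows "ml_error_prob P S X Y = 0"
proof -
  have finE: "finite E" "E \<subseteq> space P" using U by (auto simp: uniform_on_def intro: finite_subset)
  have m: "measure P B = card (E \<inter> B) / card E" if "B \<subseteq> space P" for B
    using U that by (auto simp: uniform_on_def)
  have dec: "ml_decoder P S X Y (Y \<omega>) = X \<omega>" if \<omega>: "\<omega> \<in> E" for \<omega>
  proof -
    let ?L = "\<lambda>m. \<P>(\<omega>' in P. Y \<omega>' = Y \<omega> \<bar> X \<omega>' = m)"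
    have "E \<inter> {\<omega>' \<in> space P. Y \<omega>' = Y \<omega> \<and> X \<omega>' = X \<omega>} \<noteq> {}"
      "E \<inter> {\<omega>' \<in> space P. X \<omega>' = X \<omega>} \<noteq> {}"
      using \<omega> finE by auto
    then have pos: "?L (X \<omega>) > 0"
      using finE by (auto simp: cond_prob_def m card_gt_0_iff intro!: divide_pos_pos)
    \<comment> \<open>On \<open>E\<close> a different message is incompatible with the observed
      value, so the numerator vanishes. This includes messages of probability zero, whose likelihood
      is a division by zero and hence \<open>0\<close>.\<close>
    have zero: "?L m = 0" if "m \<noteq> X \<omega>" for m
    proof -
      have "E \<inter> {\<omega>' \<in> space P. Y \<omega>' = Y \<omega> \<and> X \<omega>' = m} = {}" using det \<omega> that by blast
      then show ?thesis by (simp add: cond_prob_def m)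
    qed
    show ?thesis
      unfolding ml_decoder_def arg_max_on_def arg_max_def is_arg_max_def
    proof (rule some_equality)
      show "X \<omega> \<in> S \<and> \<not> (\<exists>m. m \<in> S \<and> ?L (X \<omega>) < ?L m)"
        using S[OF \<omega>] pos zero by (metis less_irrefl order.asym)
      fix m assume "m \<in> S \<and> \<not> (\<exists>m'. m' \<in> S \<and> ?L m < ?L m')"
      then show "m = X \<omega>" using S[OF \<omega>] pos zero by metis
    qed
  qed
  \<comment> \<open>Decoding can fail only outside \<open>E\<close>, where \<open>P\<close> has no
    mass.\<close>
  then have "E \<inter> {\<omega> \<in> space P. ml_decoder P S X Y (Y \<omega>) \<noteq> X \<omega>} = {}" by auto
  then show ?thesis by (simp add: ml_error_prob_def m)
qed

section \<open>Cardinality and finiteness of the outcome space\<close>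

text \<open>Vectors of length \<open>n\<close> correspond to extensional functions on
  \<open>{..<n}\<close>, which \<open>card_PiE\<close> counts.\<close>

lemma card_carrier_vec: "card (carrier_vec n :: 'a :: finite vec set) = CARD('a) ^ n"
proof -
  have "bij_betw (\<lambda>v. restrict (\<lambda>i. v $ i) {..<n}) (carrier_vec n :: 'a vec set) ({..<n} \<rightarrow>\<^sub>E UNIV)"
  proof (rule bij_betw_byWitness[where f' = "Matrix.vec n"])
    show "\<forall>v\<in>carrier_vec n. Matrix.vec n (restrict (\<lambda>i. v $ i) {..<n}) = v"
      by auto
    show "\<forall>g\<in>{..<n} \<rightarrow>\<^sub>E UNIV. restrict (\<lambda>i. Matrix.vec n g $ i) {..<n} = (g :: nat \<Rightarrow> 'a)"
    proof (intro ballI ext)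
      fix g :: "nat \<Rightarrow> 'a" and i assume g: "g \<in> {..<n} \<rightarrow>\<^sub>E UNIV"
      show "restrict (\<lambda>i. Matrix.vec n g $ i) {..<n} i = g i"
        using PiE_arb[OF g, of i] by (cases "i < n") simp_all
    qed
  qed (intro image_subsetI, simp)+
  from bij_betw_same_card[OF this] show ?thesis by (simp add: card_PiE)
qed

lemma finite_carrier_vec: "finite (carrier_vec n :: 'a :: finite vec set)"
  by (rule card_ge_0_finite) (simp add: card_carrier_vec finite_UNIV_card_ge_0)

lemma finite_carrier_mat: "finite (carrier_mat m n :: 'a :: finite mat set)"
proof (rule finite_subset)
  show "(carrier_mat m n :: 'a mat set) \<subseteq>
      Matrix.mat m n ` (({..<m} \<times> {..<n}) \<rightarrow>\<^sub>E UNIV)"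
  proof
    fix A :: "'a mat" assume A: "A \<in> carrier_mat m n"
    define g where "g = restrict (\<lambda>p. A $$ p) ({..<m} \<times> {..<n})"
    have "A = Matrix.mat m n g" using A by (intro eq_matI) (simp_all add: g_def)
    moreover have "g \<in> ({..<m} \<times> {..<n}) \<rightarrow>\<^sub>E UNIV" by (simp add: g_def)
    ultimately show "A \<in> Matrix.mat m n ` (({..<m} \<times> {..<n}) \<rightarrow>\<^sub>E UNIV)" by (rule image_eqI)
  qed
qed (auto intro!: finite_PiE)

lemma finite_spir_outcomes:
  "finite (spir_outcomes f H J :: 'a :: finite outcome set)"
proof (rule finite_subset)
  let ?D = "({..<f} \<rightarrow>\<^sub>E carrier_vec (dim_col J)) \<times> carrier_vec (dim_col H) \<times> {..<f} \<times>
    carrier_mat (dim_col H) (f * dim_col J) ::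
    ((nat \<Rightarrow> 'a vec) \<times> 'a vec \<times> nat \<times> 'a mat) set"
  show "spir_outcomes f H J \<subseteq> (\<lambda>(m, u, k, r). \<lparr>Files = m, Seed = u, Index = k, UserRand = r\<rparr>) ` ?D"
    by (rule subsetI, rule image_eqI[of _ _ "(Files \<omega>, Seed \<omega>, Index \<omega>, UserRand \<omega>)" for \<omega>])
      (auto simp: spir_outcomes_def)
  show "finite ((\<lambda>(m, u, k, r). \<lparr>Files = m, Seed = u, Index = k, UserRand = r\<rparr>) ` ?D)"
    by (intro finite_imageI finite_cartesian_product finite_PiE finite_carrier_vec
        finite_carrier_mat) auto
qed

text \<open>Makes the conditional laws meaningful; zero files and a zero seed give a
  witness.\<close>

lemma spir_outcomes_nonempty:
  assumes "k < f" "r \<in> carrier_mat (dim_col H) (f * dim_col J)"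
  shows "{\<omega> \<in> spir_outcomes f H (J :: 'a :: zero mat). Index \<omega> = k \<and> UserRand \<omega> = r} \<noteq> {}"
proof -
  have "\<lparr>Files = \<lambda>i\<in>{..<f}. 0\<^sub>v (dim_col J), Seed = 0\<^sub>v (dim_col H), Index = k, UserRand = r\<rparr>
      \<in> {\<omega> \<in> spir_outcomes f H J. Index \<omega> = k \<and> UserRand \<omega> = r}"
    using assms by (auto simp: spir_outcomes_def)
  then show ?thesis by blast
qed

section \<open>Correctness, server secrecy and user secrecy\<close>

text \<open>By \<open>server_answer_eq\<close> the answers of \<open>A\<close> are images of file
  \<open>k\<close>, extended by a second component, under the rows held by \<open>A\<close>.
  Acceptance recovers the first \<open>x\<close> coordinates of this argument, that is, file
  \<open>k\<close>, and a message determined by the answers is decoded without error.\<close>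

lemma spir_correctI:
  fixes J H :: "'a :: {field, finite} mat"
  assumes J: "J \<in> carrier_mat z x" and H: "H \<in> carrier_mat z y"
    and acc: "accepts x y (hcat J H) \<tau> \<AA>"
  shows "spir_correct \<AA> f H J \<tau>"
  unfolding spir_correct_def
proof (intro ballI allI impI)
  fix r :: "'a mat" and k A
  assume r: "r \<in> carrier_mat (dim_col H) (f * dim_col J)" and k: "k < f" and A: "A \<in> \<AA>"
  let ?E = "{\<omega> \<in> spir_outcomes f H J. Index \<omega> = k \<and> UserRand \<omega> = r}"
  show "ml_error_prob (given (spir_space f H J) (\<lambda>\<omega>. Index \<omega> = k \<and> UserRand \<omega> = r))
      (carrier_vec (dim_col J)) (\<lambda>\<omega>. Files \<omega> k) (answers f H J \<tau> A) = 0"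
  proof (rule ml_error_prob_zero[of _ ?E])
    show "uniform_on (given (spir_space f H J) (\<lambda>\<omega>. Index \<omega> = k \<and> UserRand \<omega> = r)) ?E"
      unfolding spir_space_def
      by (rule uniform_on_given[OF finite_spir_outcomes spir_outcomes_nonempty[OF k r]])
    fix \<omega> assume \<omega>: "\<omega> \<in> ?E"
    then show F: "Files \<omega> k \<in> carrier_vec (dim_col J)" using k by (auto simp: spir_outcomes_def)
    fix \<omega>' assume \<omega>': "\<omega>' \<in> ?E" and eq: "answers f H J \<tau> A \<omega> = answers f H J \<tau> A \<omega>'"
    have F': "Files \<omega>' k \<in> carrier_vec (dim_col J)" using \<omega>' k by (auto simp: spir_outcomes_def)
    \<comment> \<open>The second component of the argument of the answers; it may differ between the
      two outcomes.\<close>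
    define g where "g \<omega> = r *\<^sub>v concat_files f x (Files \<omega>) + Seed \<omega>" for \<omega> :: "'a outcome"
    have g: "g \<omega> \<in> carrier_vec y" "g \<omega>' \<in> carrier_vec y"
      using \<omega> \<omega>' r J H by (auto simp: g_def spir_outcomes_def)
    show "Files \<omega> k = Files \<omega>' k"
    proof (rule eq_vecI)
      fix i assume "i < dim_vec (Files \<omega>' k)"
      then have i: "i < x" using F' J by simp
      have "(Files \<omega> k @\<^sub>v g \<omega>) $ i = (Files \<omega>' k @\<^sub>v g \<omega>') $ i"
      proof (rule accepts_determines[OF hcat_carrier[OF J H] acc A])
        show "Files \<omega> k @\<^sub>v g \<omega> \<in> carrier_vec (x + y)" "Files \<omega>' k @\<^sub>v g \<omega>' \<in> carrier_vec (x + y)"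
          using F F' g J by auto
        fix j assume "j \<in> A"
        then have "server_answer f H J \<tau> j \<omega> = server_answer f H J \<tau> j \<omega>'"
          using fun_cong[OF eq, of j] by (simp add: answers_def)
        then show "rows_at \<tau> (hcat J H) {j} *\<^sub>v (Files \<omega> k @\<^sub>v g \<omega>) =
            rows_at \<tau> (hcat J H) {j} *\<^sub>v (Files \<omega>' k @\<^sub>v g \<omega>')"
          using \<omega> \<omega>' server_answer_eq[OF J H, of \<omega> f \<tau> j] server_answer_eq[OF J H, of \<omega>' f \<tau> j]
          by (simp add: g_def)
      qed (rule i)
      then show "Files \<omega> k $ i = Files \<omega>' k $ i" using i F F' J g by simp
    qed (use F F' in simp)
  qed
qed

text \<open>The fibres of the other files are matched by \<open>\<phi>\<close>, which puts a
  prescribed tuple in their place and adjusts the seed so that the masked second component stays the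
  same. File \<open>k\<close> is kept, so every answer is kept.\<close>

lemma server_secretI:
  fixes J H :: "'a :: {field, finite} mat"
  assumes J: "J \<in> carrier_mat z x" and H: "H \<in> carrier_mat z y"
  shows "server_secret n f H J \<tau>"
  unfolding server_secret_def
proof (intro ballI allI impI)
  fix r :: "'a mat" and k
  assume r: "r \<in> carrier_mat (dim_col H) (f * dim_col J)" and k: "k < f"
  let ?E = "{\<omega> \<in> spir_outcomes f H J. UserRand \<omega> = r \<and> Index \<omega> = k}"
  let ?X = "answers f H J \<tau> {..<n}" and ?Y = "other_files f k"
  have dims: "dim_col J = x" "dim_col H = y" using J H by auto
  have r': "r \<in> carrier_mat y (f * x)" using r dims by simp
  define p where "p m = r *\<^sub>v concat_files f x m" for m
  have p: "p m \<in> carrier_vec y" for m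
    unfolding p_def using r' by (rule mult_mat_vec_carrier) simp
  have ne: "?E \<noteq> {}" using spir_outcomes_nonempty[OF k r] by (simp add: conj_commute)
  show "mutual_info (given (spir_space f H J) (\<lambda>\<omega>. UserRand \<omega> = r \<and> Index \<omega> = k)) ?X ?Y = 0"
  proof (rule uniform_on_mutual_info_zero)
    show "uniform_on (given (spir_space f H J) (\<lambda>\<omega>. UserRand \<omega> = r \<and> Index \<omega> = k)) ?E"
      unfolding spir_space_def by (rule uniform_on_given[OF finite_spir_outcomes ne])
    show "card {\<omega> \<in> ?E. ?X \<omega> = a \<and> ?Y \<omega> = b} * card ?E =
        card {\<omega> \<in> ?E. ?X \<omega> = a} * card {\<omega> \<in> ?E. ?Y \<omega> = b}" for a b
    proof (rule card_indep_if_fibre_injections)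
      show "finite ?E" using finite_spir_outcomes by (rule finite_subset[rotated]) auto
      fix b b' assume "b \<in> ?Y ` ?E" "b' \<in> ?Y ` ?E"
      then obtain \<omega>\<^sub>0 where "\<omega>\<^sub>0 \<in> ?E" and b'_eq: "b' = ?Y \<omega>\<^sub>0" by blast
      then have "Files \<omega>\<^sub>0 \<in> {..<f} \<rightarrow>\<^sub>E carrier_vec x" using dims by (simp add: spir_outcomes_def)
      then have b': "b' \<in> ({..<f} - {k}) \<rightarrow>\<^sub>E carrier_vec x"
        unfolding b'_eq other_files_def restrict_PiE_iff by (blast dest: PiE_mem)
      \<comment> \<open>\<open>b'\<close> is \<open>undefined\<close> at \<open>k\<close> and
        outside \<open>{..<f}\<close>; filling in position \<open>k\<close> gives an extensional
        family of \<open>f\<close> files again.\<close>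
      define m where "m \<omega> = b'(k := Files \<omega> k)" for \<omega> :: "'a outcome"
      \<comment> \<open>The seed absorbs the change in the product of \<open>r\<close> with the
        files: the old value of \<open>p\<close> is added and the new one removed.\<close>
      define \<phi> where "\<phi> \<omega> = \<omega>\<lparr>Files := m \<omega>, Seed := Seed \<omega> + p (Files \<omega>) - p (m \<omega>)\<rparr>" for \<omega>
      show "\<exists>\<phi>. inj_on \<phi> {\<omega> \<in> ?E. ?Y \<omega> = b} \<and>
          (\<forall>\<omega>\<in>?E. ?Y \<omega> = b \<longrightarrow> \<phi> \<omega> \<in> ?E \<and> ?Y (\<phi> \<omega>) = b' \<and> ?X (\<phi> \<omega>) = ?X \<omega>)"
      proof (intro exI[of _ \<phi>] conjI inj_onI ballI impI)
        fix \<omega> \<omega>' assume \<omega>: "\<omega> \<in> {\<omega> \<in> ?E. ?Y \<omega> = b}" and \<omega>': "\<omega>' \<in> {\<omega> \<in> ?E. ?Y \<omega> = b}"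
          and eq: "\<phi> \<omega> = \<phi> \<omega>'"
        have meq: "m \<omega> = m \<omega>'" using arg_cong[OF eq, of Files] by (simp add: \<phi>_def)
        \<comment> \<open>Within a fibre of \<open>?Y\<close> the other files are already fixed,
          file \<open>k\<close> is stored unchanged in \<open>m\<close>, and from index
          \<open>f\<close> on both families are \<open>undefined\<close>.\<close>
        have F: "Files \<omega> = Files \<omega>'"
        proof
          fix i
          have "?Y \<omega> i = ?Y \<omega>' i" using \<omega> \<omega>' by simp
          moreover have "Files \<omega> k = Files \<omega>' k" using fun_cong[OF meq, of k] by (simp add: m_def)
          moreover have "Files \<omega> i = Files \<omega>' i" if "\<not> i < f"
          proof -
            have P: "Files \<omega> \<in> {..<f} \<rightarrow>\<^sub>E carrier_vec x" "Files \<omega>' \<in> {..<f} \<rightarrow>\<^sub>E carrier_vec x"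
              using \<omega> \<omega>' dims by (simp_all add: spir_outcomes_def)
            show ?thesis using that PiE_arb[OF P(1), of i] PiE_arb[OF P(2), of i] by simp
          qed
          ultimately show "Files \<omega> i = Files \<omega>' i"
            by (cases "i < f"; cases "i = k") (simp_all add: other_files_def)
        qed
        have s: "Seed \<omega> \<in> carrier_vec y" "Seed \<omega>' \<in> carrier_vec y"
          using \<omega> \<omega>' dims by (auto simp: spir_outcomes_def)
        have seq: "Seed \<omega> + p (Files \<omega>) - p (m \<omega>) = Seed \<omega>' + p (Files \<omega>) - p (m \<omega>)"
          using arg_cong[OF eq, of Seed] by (simp add: \<phi>_def F meq)
        have "Seed \<omega> = Seed \<omega>'"
        proof (rule eq_vecI)
          fix i assume "i < dim_vec (Seed \<omega>')"
          then have "i < y" using s by simp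
          then show "Seed \<omega> $ i = Seed \<omega>' $ i"
            using arg_cong[OF seq, of "\<lambda>v. v $ i"] s p[of "Files \<omega>"] p[of "m \<omega>"] by simp
        qed (use s in simp)
        then show "\<omega> = \<omega>'" using F \<omega> \<omega>' by (intro outcome.equality) auto
      next
        fix \<omega> assume \<omega>: "\<omega> \<in> ?E"
        then have s: "Seed \<omega> \<in> carrier_vec y" and Fk: "Files \<omega> k \<in> carrier_vec x"
          using dims k by (auto simp: spir_outcomes_def dest: PiE_mem)
        have "m \<omega> \<in> {..<f} \<rightarrow>\<^sub>E carrier_vec x"
          using PiE_fun_upd[OF Fk b', of k] k by (simp add: m_def insert_absorb)
        then show \<phi>: "\<phi> \<omega> \<in> ?E"
          using \<omega> dims s p r' by (simp add: spir_outcomes_def \<phi>_def)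
        have "?Y (\<phi> \<omega>) = restrict b' ({..<f} - {k})"
          unfolding other_files_def \<phi>_def m_def by (rule restrict_ext) simp
        then show "?Y (\<phi> \<omega>) = b'" using PiE_restrict[OF b'] by simp
        have "p (m \<omega>) + (Seed \<omega> + p (Files \<omega>) - p (m \<omega>)) = p (Files \<omega>) + Seed \<omega>"
          using s p[of "Files \<omega>"] p[of "m \<omega>"] by (intro eq_vecI) auto
        then have "server_answer f H J \<tau> j (\<phi> \<omega>) = server_answer f H J \<tau> j \<omega>" for j
          using \<omega> \<phi> server_answer_eq[OF J H, of "\<phi> \<omega>" f \<tau> j] server_answer_eq[OF J H, of \<omega> f \<tau> j]
          by (simp add: \<phi>_def m_def p_def)
        then show "?X (\<phi> \<omega>) = ?X \<omega>" by (simp add: answers_def)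
      qed
    qed
  qed
qed

text \<open>By \<open>rejects_factor\<close> the index enters the queries of \<open>B\<close> only
  as an offset added to the user's randomness before multiplication by the rows of \<open>H\<close>.
  A change of index can thus be undone by a shift of that randomness, which matches the fibres of
  \<open>Index\<close> while keeping the queries.\<close>

lemma user_secretI:
  fixes J H :: "'a :: {field, finite} mat"
  assumes J: "J \<in> carrier_mat z x" and H: "H \<in> carrier_mat z y" and f: "f > 0"
    and rej: "rejects x y (hcat J H) \<tau> \<BB>"
  shows "user_secret \<BB> f H J \<tau>"
  unfolding user_secret_def
proof
  fix B assume B: "B \<in> \<BB>"
  let ?E = "spir_outcomes f H J" and ?Q = "server_query f H J \<tau> B"
  have dims: "dim_col J = x" "dim_col H = y" using J H by auto
  obtain S where S: "S \<in> carrier_mat y x" and JB: "rows_at \<tau> J B = rows_at \<tau> H B * S"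
    using rejects_factor[OF J H rej B] by blast
  note HB = rows_at_carrier[OF H, of \<tau> B]
  \<comment> \<open>The offset through which index \<open>k\<close> enters.\<close>
  define p where "p k = S * block_mat f x k" for k
  have p: "p k \<in> carrier_mat y (f * x)" for k
    unfolding p_def using S by (rule mult_carrier_mat) simp
  have query: "?Q \<omega> = rows_at \<tau> H B * (p (Index \<omega>) + UserRand \<omega>)" if \<omega>: "\<omega> \<in> ?E" for \<omega>
  proof -
    have R: "UserRand \<omega> \<in> carrier_mat y (f * x)" using \<omega> dims by (auto simp: spir_outcomes_def)
    have "?Q \<omega> = rows_at \<tau> H B * S * block_mat f x (Index \<omega>) + rows_at \<tau> H B * UserRand \<omega>"
      using server_query_eq[OF J H \<omega>, of \<tau> B] unfolding JB .
    also have "rows_at \<tau> H B * S * block_mat f x (Index \<omega>) = rows_at \<tau> H B * p (Index \<omega>)"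
      unfolding p_def using HB S block_mat_carrier by (rule assoc_mult_mat)
    finally show ?thesis by (simp add: mult_add_distrib_mat[OF HB p R])
  qed
  have ne: "?E \<noteq> {}"
    using spir_outcomes_nonempty[OF f zero_carrier_mat] by blast
  \<comment> \<open>The index is the variable whose fibres are matched, so it stands second here;
    symmetry restores the order for the mutual information.\<close>
  have card: "card {\<omega> \<in> ?E. ?Q \<omega> = a \<and> Index \<omega> = b} * card ?E =
      card {\<omega> \<in> ?E. ?Q \<omega> = a} * card {\<omega> \<in> ?E. Index \<omega> = b}" for a b
  proof (rule card_indep_if_fibre_injections)
    show "finite ?E" by (rule finite_spir_outcomes)
    fix k k' assume "k \<in> Index ` ?E" "k' \<in> Index ` ?E"
    then have k': "k' < f" by (auto simp: spir_outcomes_def)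
    \<comment> \<open>The shift cancels the change of the offset from \<open>p k\<close> to
      \<open>p k'\<close>; for fixed \<open>k\<close> and \<open>k'\<close> it is a translation of
      \<open>UserRand\<close>, hence injective on the fibre.\<close>
    define \<phi> where "\<phi> \<omega> = \<omega>\<lparr>Index := k', UserRand := UserRand \<omega> + p k - p k'\<rparr>"
      for \<omega> :: "'a outcome"
    show "\<exists>\<phi>. inj_on \<phi> {\<omega> \<in> ?E. Index \<omega> = k} \<and>
        (\<forall>\<omega>\<in>?E. Index \<omega> = k \<longrightarrow> \<phi> \<omega> \<in> ?E \<and> Index (\<phi> \<omega>) = k' \<and> ?Q (\<phi> \<omega>) = ?Q \<omega>)"
    proof (intro exI[of _ \<phi>] conjI inj_onI ballI impI)
      fix \<omega> \<omega>' assume \<omega>: "\<omega> \<in> {\<omega> \<in> ?E. Index \<omega> = k}" and \<omega>': "\<omega>' \<in> {\<omega> \<in> ?E. Index \<omega> = k}"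
        and eq: "\<phi> \<omega> = \<phi> \<omega>'"
      have R: "UserRand \<omega> \<in> carrier_mat y (f * x)" "UserRand \<omega>' \<in> carrier_mat y (f * x)"
        using \<omega> \<omega>' dims by (auto simp: spir_outcomes_def)
      have Req: "UserRand \<omega> + p k - p k' = UserRand \<omega>' + p k - p k'"
        using arg_cong[OF eq, of UserRand] by (simp add: \<phi>_def)
      have "UserRand \<omega> = UserRand \<omega>'"
      proof (rule eq_matI)
        fix i j assume "i < dim_row (UserRand \<omega>')" "j < dim_col (UserRand \<omega>')"
        then have "i < y" "j < f * x" using R by auto
        then show "UserRand \<omega> $$ (i, j) = UserRand \<omega>' $$ (i, j)"
          using arg_cong[OF Req, of "\<lambda>M. M $$ (i, j)"] R p[of k] p[of k'] by simp
      qed (use R in simp_all)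
      moreover have "Files \<omega> = Files \<omega>'" "Seed \<omega> = Seed \<omega>'"
        using arg_cong[OF eq, of Files] arg_cong[OF eq, of Seed] by (simp_all add: \<phi>_def)
      ultimately show "\<omega> = \<omega>'" using \<omega> \<omega>' by (intro outcome.equality) auto
    next
      fix \<omega> assume \<omega>: "\<omega> \<in> ?E" "Index \<omega> = k"
      then have R: "UserRand \<omega> \<in> carrier_mat y (f * x)" using dims by (auto simp: spir_outcomes_def)
      have "UserRand \<omega> + p k - p k' \<in> carrier_mat y (f * x)" using p by (intro minus_carrier_mat)
      then show \<phi>: "\<phi> \<omega> \<in> ?E" using \<omega> k' dims by (auto simp: spir_outcomes_def \<phi>_def)
      show "Index (\<phi> \<omega>) = k'" by (simp add: \<phi>_def)
      have "p k' + (UserRand \<omega> + p k - p k') = p k + UserRand \<omega>"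
        using R p[of k] p[of k'] by (intro eq_matI) auto
      then show "?Q (\<phi> \<omega>) = ?Q \<omega>"
        using query[OF \<phi>] query[OF \<omega>(1)] \<omega>(2) by (simp add: \<phi>_def)
    qed
  qed
  show "mutual_info (spir_space f H J) Index ?Q = 0"
  proof (rule uniform_on_mutual_info_zero)
    show "uniform_on (spir_space f H J) ?E"
      unfolding spir_space_def by (rule uniform_on_uniform_count_measure[OF finite_spir_outcomes ne])
    show "card {\<omega> \<in> ?E. Index \<omega> = b \<and> ?Q \<omega> = a} * card ?E =
        card {\<omega> \<in> ?E. Index \<omega> = b} * card {\<omega> \<in> ?E. ?Q \<omega> = a}" for a b
      using card[of a b] by (simp add: conj_commute mult.commute)
  qed
qed

section \<open>The two rates\<close>

lemma log_card_carrier_vec: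
  "log 2 (card (carrier_vec m :: 'a :: finite vec set)) = m * log 2 CARD('a)"
  by (simp add: card_carrier_vec log_nat_power)

text \<open>A field contains the distinct elements \<open>0\<close> and \<open>1\<close>, so the
  logarithm of its size is positive and can be cancelled from the quotients defining the
  rates.\<close>

lemma log_card_field_nonzero: "log 2 (CARD('a :: {field, finite})) \<noteq> 0"
proof -
  have "card {0 :: 'a, 1} \<le> CARD('a)" by (rule card_mono) auto
  then have "0 < log 2 (CARD('a))" by simp
  then show ?thesis by (rule less_imp_neq[symmetric])
qed

text \<open>The fibres of \<open>\<tau>\<close> over the servers partition the \<open>z\<close>
  rows, so the answer lengths add up to \<open>z\<close>.\<close>

lemma pir_rate_eq:
  fixes J :: "'a :: {field, finite} mat"
  assumes J: "J \<in> carrier_mat z x" and \<tau>: "\<tau> \<in> {..<z} \<rightarrow> {..<n}"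
  shows "pir_rate n J \<tau> = real x / real z"
proof -
  have "(\<Sum>j<n. card {i. i < z \<and> \<tau> i = j}) = z"
    using sum.group[of "{..<z}" "{..<n}" \<tau> "\<lambda>_. 1 :: nat"] \<tau> by (auto simp: Pi_def)
  then have "(\<Sum>j<n. log 2 (card (carrier_vec (card {i. i < z \<and> \<tau> i = j}) :: 'a vec set))) =
      z * log 2 CARD('a)"
    unfolding log_card_carrier_vec sum_distrib_right[symmetric] of_nat_sum[symmetric] by simp
  then show ?thesis
    using J log_card_field_nonzero[where 'a = 'a] by (simp add: pir_rate_def log_card_carrier_vec)
qed

lemma shared_randomness_rate_eq:
  fixes H J :: "'a :: {field, finite} mat"
  shows "shared_randomness_rate H J = real (dim_col H) / real (dim_col J)"
  using log_card_field_nonzero[where 'a = 'a]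
  by (simp add: shared_randomness_rate_def log_card_carrier_vec)

theorem theorem4:
  fixes n x y z f :: nat
    and \<AA> \<BB> :: "nat set set"
    and G' G'' :: "'a :: {field, finite} mat"
    and \<tau> :: "nat \<Rightarrow> nat"
  assumes "n > 0" "x > 0" "y > 0" "z > 0"
    and "access_structure n \<AA> \<BB>"
    and "G' \<in> carrier_mat z x" "G'' \<in> carrier_mat z y"
    and "is_mmsp \<AA> \<BB> n x y z (hcat G' G'') \<tau>"
    and "f \<ge> 2"
  shows "is_csspir \<AA> \<BB> n f G'' G' \<tau> \<and>
    pir_rate n G' \<tau> = real x / real z \<and>
    shared_randomness_rate G'' G' = real y / real x"
proof -
  note G = \<open>G' \<in> carrier_mat z x\<close> \<open>G'' \<in> carrier_mat z y\<close>
  have mmsp: "\<tau> \<in> {..<z} \<rightarrow> {..<n}" "accepts x y (hcat G' G'') \<tau> \<AA>" "rejects x y (hcat G' G'') \<tau> \<BB>"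
    using assms(8) by (auto simp: is_mmsp_def)
  have "spir_description n G'' G' \<tau>" using G mmsp(1) by (simp add: spir_description_def)
  moreover have "user_secret \<BB> f G'' G' \<tau>"
    using user_secretI[OF G _ mmsp(3)] \<open>f \<ge> 2\<close> by simp
  ultimately show ?thesis
    using spir_correctI[OF G mmsp(2)] server_secretI[OF G] pir_rate_eq[OF G(1) mmsp(1)]
      shared_randomness_rate_eq[of G'' G'] G
    by (simp add: is_csspir_def)
qed

end
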